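(* Let $T$ be a tree of order $n\ge 2$. Then $w(T) < \frac{3}{2}\pi(T)$.
   Context: For a tree $T$, between any two distinct vertices $x,y$ there is a unique path $P_{x,y}$. The all-to-all routing of $T$ is $R=\{P_{x,y} : \{x,y\}\subseteq V(T),\ x\ne y\}$ (one path per unordered pair of distinct vertices). A $k$-path-coloring $\phi: R\to\{1,\dots,k\}$ is proper if $\phi(P)\neq\phi(P')$ whenever the distinct paths $P,P'$ share at least one edge. The undirected optical index $w(T)$ is the minimum $k$ for which a proper $k$-path-coloring of $R$ exists. For an edge $e$, the edge-load $\ell_T(e)$ is the number of paths in $R$ containing $e$, and the edge-forwarding index is $\pi(T)=\max_{e\in E(T)}\ell_T(e)$. *)

theory Defs
  imports Complex_Main
begin

text \<open>Finite simple undirected graphs are given by a vertex set \<open>V\<close> and a set \<open>E\<close> of two-element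
  subsets of \<open>V\<close>.\<close>

definition simple_graph :: "'a set \<Rightarrow> 'a set set \<Rightarrow> bool" where
  "simple_graph V E \<longleftrightarrow> finite V \<and> (\<forall>e\<in>E. \<exists>x\<in>V. \<exists>y\<in>V. x \<noteq> y \<and> e = {x, y})"

fun walk_edges :: "'a list \<Rightarrow> 'a set set" where
  "walk_edges (x # y # zs) = insert {x, y} (walk_edges (y # zs))"
| "walk_edges _ = {}"

definition path_between :: "'a set \<Rightarrow> 'a set set \<Rightarrow> 'a \<Rightarrow> 'a list \<Rightarrow> 'a \<Rightarrow> bool" where
  "path_between V E x p y \<longleftrightarrow>
     p \<noteq> [] \<and> hd p = x \<and> last p = y \<and> distinct p \<and> set p \<subseteq> V \<and> walk_edges p \<subseteq> E"

definition connected_graph :: "'a set \<Rightarrow> 'a set set \<Rightarrow> bool" where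
  "connected_graph V E \<longleftrightarrow> V \<noteq> {} \<and> (\<forall>x\<in>V. \<forall>y\<in>V. \<exists>p. path_between V E x p y)"

definition graph_cycle :: "'a set \<Rightarrow> 'a set set \<Rightarrow> 'a list \<Rightarrow> bool" where
  "graph_cycle V E p \<longleftrightarrow>
     length p \<ge> 3 \<and> distinct p \<and> set p \<subseteq> V \<and> walk_edges p \<subseteq> E \<and> {last p, hd p} \<in> E"

definition is_tree :: "'a set \<Rightarrow> 'a set set \<Rightarrow> bool" where
  "is_tree V E \<longleftrightarrow> simple_graph V E \<and> connected_graph V E \<and> (\<nexists>p. graph_cycle V E p)"

text \<open>An undirected path with distinct end vertices is determined by its edges, so it is
  represented by its edge set; in particular the path from \<open>x\<close> to \<open>y\<close> and its reversal are the
  same object. The description below is proper because paths in a tree are unique.\<close>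

definition tree_path :: "'a set \<Rightarrow> 'a set set \<Rightarrow> 'a \<Rightarrow> 'a \<Rightarrow> 'a set set" where
  "tree_path V E x y = (THE P. \<exists>p. path_between V E x p y \<and> P = walk_edges p)"

definition all_to_all_routing :: "'a set \<Rightarrow> 'a set set \<Rightarrow> 'a set set set" where
  "all_to_all_routing V E = {tree_path V E x y | x y. {x, y} \<subseteq> V \<and> x \<noteq> y}"

definition proper_path_coloring ::
    "'a set \<Rightarrow> 'a set set \<Rightarrow> nat \<Rightarrow> ('a set set \<Rightarrow> nat) \<Rightarrow> bool" where
  "proper_path_coloring V E k \<phi> \<longleftrightarrow>
     \<phi> ` all_to_all_routing V E \<subseteq> {1..k} \<and>
     (\<forall>P\<in>all_to_all_routing V E. \<forall>P'\<in>all_to_all_routing V E.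
        P \<noteq> P' \<and> P \<inter> P' \<noteq> {} \<longrightarrow> \<phi> P \<noteq> \<phi> P')"

definition optical_index :: "'a set \<Rightarrow> 'a set set \<Rightarrow> nat" where
  "optical_index V E = (LEAST k. \<exists>\<phi>. proper_path_coloring V E k \<phi>)"

definition edge_load :: "'a set \<Rightarrow> 'a set set \<Rightarrow> 'a set \<Rightarrow> nat" where
  "edge_load V E e = card {P \<in> all_to_all_routing V E. e \<in> P}"

definition edge_forwarding_index :: "'a set \<Rightarrow> 'a set set \<Rightarrow> nat" where
  "edge_forwarding_index V E = Max (edge_load V E ` E)"

end

theory Submission
  imports Defs
begin

text \<open>At a vertex \<open>v\<close>, a routing path meets one or two of the edges incident to \<open>v\<close>. Those meeting
  two are the edges of a multigraph whose nodes are the edges incident to \<open>v\<close>; its degrees are below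
  \<open>\<pi>\<close>, so Shannon's theorem colors it with at most \<open>3(\<pi> - 1)/2\<close> colors. The paths meeting only one
  edge at \<open>v\<close> are added greedily, which needs at most \<open>\<pi>\<close> colors in total. Finally the local
  colorings are glued along the tree: when a connected vertex set is enlarged by a neighbor \<open>u\<close>, the
  paths already colored that also pass through an edge at \<open>u\<close> all contain the connecting edge, so
  they have distinct colors in both colorings and a permutation of colors makes the two agree.\<close>

section \<open>Edge colorings of multigraphs\<close>

text \<open>Edges are indices, so parallel edges are allowed, and \<open>ends i\<close> may have any
  size. The same notion thus covers paths that stop at a vertex and, with
  \<open>ends P = P \<inter> E\<close>, proper colorings of the whole routing.\<close>

definition edge_coloring :: "('i \<Rightarrow> 'n set) \<Rightarrow> 'i set \<Rightarrow> nat \<Rightarrow> ('i \<Rightarrow> nat) \<Rightarrow> bool" where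
  "edge_coloring ends I K c \<longleftrightarrow> (\<forall>i\<in>I. c i < K) \<and>
     (\<forall>i\<in>I. \<forall>j\<in>I. i \<noteq> j \<and> ends i \<inter> ends j \<noteq> {} \<longrightarrow> c i \<noteq> c j)"

definition missing :: "('i \<Rightarrow> 'n set) \<Rightarrow> 'i set \<Rightarrow> nat \<Rightarrow> ('i \<Rightarrow> nat) \<Rightarrow> 'n \<Rightarrow> nat set" where
  "missing ends I K c x = {a. a < K \<and> (\<forall>i\<in>I. x \<in> ends i \<longrightarrow> c i \<noteq> a)}"

section \<open>Missing colors and extension by one edge\<close>

lemma edge_coloringD:
  assumes "edge_coloring ends I K c" "i \<in> I" "j \<in> I" "x \<in> ends i" "x \<in> ends j" "c i = c j"
  shows "i = j"
  using assms unfolding edge_coloring_def by blast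

lemma finite_missing: "finite (missing ends I K c x)"
  unfolding missing_def by simp

lemma card_missing:
  assumes "finite I"
  shows "K \<le> card (missing ends I K c x) + card {i \<in> I. x \<in> ends i}"
proof -
  have "{..<K} \<subseteq> missing ends I K c x \<union> c ` {i \<in> I. x \<in> ends i}"
    unfolding missing_def by auto
  then have "card {..<K} \<le> card (missing ends I K c x \<union> c ` {i \<in> I. x \<in> ends i})"
    using assms by (intro card_mono) (auto simp: finite_missing)
  also have "\<dots> \<le> card (missing ends I K c x) + card (c ` {i \<in> I. x \<in> ends i})"
    by (rule card_Un_le)
  also have "\<dots> \<le> card (missing ends I K c x) + card {i \<in> I. x \<in> ends i}"
    using assms by (intro add_left_mono card_image_le) auto
  finally show ?thesis by simp
qed

text \<open>Looking only at \<open>I - {e}\<close> lets this serve both for coloring a new edge and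
  for recoloring one already in \<open>I\<close>.\<close>

lemma edge_coloring_insert:
  assumes "edge_coloring ends I K c" "a < K" "\<And>x. x \<in> ends e \<Longrightarrow> a \<in> missing ends (I - {e}) K c x"
  shows "edge_coloring ends (insert e I) K (c(e := a))"
proof -
  have "c j \<noteq> a" if "j \<in> I" "j \<noteq> e" "ends e \<inter> ends j \<noteq> {}" for j
    using that assms(3) unfolding missing_def by blast
  then show ?thesis
    using assms(1,2) unfolding edge_coloring_def by (auto simp: Int_commute)
qed

text \<open>An index with a single end \<open>x\<close> conflicts only with indices at
  \<open>x\<close>, of which fewer than \<open>K\<close> are colored before it.\<close>

lemma edge_coloring_greedy:
  assumes "finite J" "edge_coloring ends I K c" "finite I"
    and "\<And>j. j \<in> J \<Longrightarrow> card (ends j) = 1"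
    and "\<And>x. card {i \<in> I \<union> J. x \<in> ends i} \<le> K"
  shows "\<exists>c. edge_coloring ends (I \<union> J) K c"
  using assms(1,4,5)
proof (induction J rule: finite_induct)
  case empty
  then show ?case using assms(2) by auto
next
  case (insert e J)
  have fin: "finite (I \<union> insert e J)"
    using insert.hyps assms(3) by simp
  have le: "card {i \<in> I \<union> J. x \<in> ends i} \<le> K" for x
    using card_mono[of "{i \<in> I \<union> insert e J. x \<in> ends i}" "{i \<in> I \<union> J. x \<in> ends i}"]
      insert.prems(2)[of x] fin by fastforce
  obtain c where c: "edge_coloring ends (I \<union> J) K c"
    using insert.IH insert.prems(1) le by blast
  show ?case
  proof (cases "e \<in> I")
    case True
    then show ?thesis using c by (auto simp: insert_absorb)
  next
    case False
    obtain x where x: "ends e = {x}"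
      using insert.prems(1)[of e] by (auto simp: card_1_singleton_iff)
    have "{i \<in> I \<union> insert e J. x \<in> ends i} = insert e {i \<in> I \<union> J. x \<in> ends i}"
      using x by auto
    moreover have "e \<notin> {i \<in> I \<union> J. x \<in> ends i}"
      using False insert.hyps by auto
    \<comment> \<open>The bound \<open>K\<close> at \<open>x\<close> also counts \<open>e\<close>,
      so the colored indices leave a color free.\<close>
    ultimately have "card {i \<in> I \<union> J. x \<in> ends i} < K"
      using insert.prems(2)[of x] fin by simp
    then have "missing ends (I \<union> J) K c x \<noteq> {}"
      using card_missing[of "I \<union> J" K ends c x] fin by auto
    then obtain a where a: "a \<in> missing ends (I \<union> J) K c x" by blast
    have "edge_coloring ends (insert e (I \<union> J)) K (c(e := a))"
      using a x by (intro edge_coloring_insert[OF c]) (auto simp: missing_def)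
    then show ?thesis by auto
  qed
qed

section \<open>Kempe chains\<close>

text \<open>\<open>C\<close> is a union of components of the subgraph colored \<open>a\<close> or
  \<open>b\<close>. Exchanging the two colors on \<open>C\<close> acts at each vertex either on all
  its edges or on none, so properness survives.\<close>

lemma Kempe_swap:
  fixes ends :: "'i \<Rightarrow> 'n set"
  assumes c: "edge_coloring ends I K c" and ab: "a < K" "b < K"
    and closed: "\<And>i. i \<in> I \<Longrightarrow> c i = a \<or> c i = b \<Longrightarrow> ends i \<subseteq> C \<or> ends i \<inter> C = {}"
  obtains c' where "edge_coloring ends I K c'"
    and "\<And>i. i \<in> I \<Longrightarrow> c i \<noteq> a \<Longrightarrow> c i \<noteq> b \<Longrightarrow> c' i = c i"
    and "\<And>x. x \<notin> C \<Longrightarrow> missing ends I K c x \<subseteq> missing ends I K c' x"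
    and "\<And>x d. d \<in> missing ends I K c x \<Longrightarrow> d \<noteq> a \<Longrightarrow> d \<noteq> b \<Longrightarrow> d \<in> missing ends I K c' x"
    and "\<And>x. x \<in> C \<Longrightarrow> a \<in> missing ends I K c x \<Longrightarrow> b \<in> missing ends I K c' x"
proof -
  define sw where "sw = (\<lambda>d. if d = a then b else if d = b then a else d)"
  define c' where "c' = (\<lambda>i. if ends i \<inter> C \<noteq> {} then sw (c i) else c i)"
  have swK: "sw d < K \<longleftrightarrow> d < K" for d
    using ab unfolding sw_def by auto
  have inj: "sw d = sw d' \<longleftrightarrow> d = d'" for d d'
    unfolding sw_def by auto
  have inC: "c' i = sw (c i)" if "x \<in> ends i" "x \<in> C" for i x
    using that unfolding c'_def by auto
  \<comment> \<open>An edge that leaves \<open>C\<close> has neither color \<open>a\<close> nor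
    \<open>b\<close>, hence \<open>sw\<close> fixes its color.\<close>
  have outC: "c' i = c i" if "i \<in> I" "x \<in> ends i" "x \<notin> C" for i x
    using that closed[of i] unfolding c'_def sw_def by auto
  show thesis
  proof (rule that[of c'])
    show "edge_coloring ends I K c'"
      unfolding edge_coloring_def
    proof (intro conjI ballI impI)
      fix i assume "i \<in> I"
      then show "c' i < K"
        using c swK unfolding edge_coloring_def c'_def by auto
    next
      fix i j assume ij: "i \<in> I" "j \<in> I" "i \<noteq> j \<and> ends i \<inter> ends j \<noteq> {}"
      then obtain x where x: "x \<in> ends i" "x \<in> ends j" by blast
      have "c i \<noteq> c j"
        using c ij unfolding edge_coloring_def by blast
      then show "c' i \<noteq> c' j"
        using inC[of x] outC[of _ x] inj x ij by (cases "x \<in> C") auto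
    qed
    show "c' i = c i" if "i \<in> I" "c i \<noteq> a" "c i \<noteq> b" for i
      using that unfolding c'_def sw_def by auto
    show "missing ends I K c x \<subseteq> missing ends I K c' x" if "x \<notin> C" for x
      using outC[OF _ _ that] unfolding missing_def by auto
    show "d \<in> missing ends I K c' x"
      if "d \<in> missing ends I K c x" "d \<noteq> a" "d \<noteq> b" for x d
      using that unfolding missing_def c'_def sw_def by auto
    show "b \<in> missing ends I K c' x" if "x \<in> C" "a \<in> missing ends I K c x" for x
      using that inC[OF _ that(1)] ab unfolding missing_def sw_def by auto
  qed
qed

text \<open>A connected multigraph on \<open>k\<close> vertices has at least \<open>k - 1\<close> edges, so if all degrees are at
  most 2 then at most two vertices have degree less than 2.\<close>

lemma component_avoiding_low_degree:
  fixes ends :: "'i \<Rightarrow> 'n set"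
  assumes fin: "finite J" and two: "\<And>j. j \<in> J \<Longrightarrow> card (ends j) = 2"
    and deg: "\<And>v. card {j \<in> J. v \<in> ends j} \<le> 2"
    and low: "card {j \<in> J. x \<in> ends j} \<le> 1" "card {j \<in> J. y \<in> ends j} \<le> 1"
      "card {j \<in> J. z \<in> ends j} \<le> 1"
    and ne: "x \<noteq> y" "x \<noteq> z" "y \<noteq> z"
  obtains C where "x \<in> C" "\<And>j. j \<in> J \<Longrightarrow> ends j \<subseteq> C \<or> ends j \<inter> C = {}" "\<not> (y \<in> C \<and> z \<in> C)"
proof -
  define W where "W = insert x (\<Union>j\<in>J. ends j)"
  have finends: "finite (ends j)" if "j \<in> J" for j
    using two[OF that] by (metis card.infinite zero_neq_numeral)
  have finW: "finite W"
    unfolding W_def using fin finends by auto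
  \<comment> \<open>Having at least |S| - 1 edges inside \<open>S\<close> replaces connectedness; a
    set of maximal size with this property is closed under \<open>J\<close>.\<close>
  define good where
    "good = (\<lambda>S. x \<in> S \<and> S \<subseteq> W \<and> card S \<le> card {j \<in> J. ends j \<subseteq> S} + 1)"
  have "good {x}"
    unfolding good_def W_def by auto
  moreover have "\<forall>S. good S \<longrightarrow> card S < Suc (card W)"
    using card_mono[OF finW] unfolding good_def by (auto simp: less_Suc_eq_le)
  ultimately obtain S where S: "good S" and max: "\<And>S'. good S' \<Longrightarrow> card S' \<le> card S"
    using ex_has_greatest_nat[of good "{x}" card "Suc (card W)"] by blast
  have finS: "finite S"
    using S finW finite_subset unfolding good_def by blast
  have closed: "ends j \<subseteq> S \<or> ends j \<inter> S = {}" if "j \<in> J" for j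
  proof (rule ccontr)
    assume "\<not> ?thesis"
    then obtain u v where uv: "u \<in> ends j" "u \<in> S" "v \<in> ends j" "v \<notin> S" by blast
    then have eq: "ends j = {u, v}"
      using two[OF that] by (auto simp: card_2_iff)
    have "insert j {j \<in> J. ends j \<subseteq> S} \<subseteq> {j \<in> J. ends j \<subseteq> insert v S}"
      using that eq uv by auto
    then have "card (insert j {j \<in> J. ends j \<subseteq> S}) \<le> card {j \<in> J. ends j \<subseteq> insert v S}"
      using fin by (intro card_mono) auto
    moreover have "j \<notin> {j \<in> J. ends j \<subseteq> S}"
      using uv by auto
    ultimately have "card {j \<in> J. ends j \<subseteq> S} + 1 \<le> card {j \<in> J. ends j \<subseteq> insert v S}"
      using fin by simp
    \<comment> \<open>The leaving edge \<open>j\<close> pays for the new vertex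
      \<open>v\<close>.\<close>
    then have "good (insert v S)"
      using S uv that finS unfolding good_def W_def by auto
    then show False
      using max[of "insert v S"] finS uv by simp
  qed
  have "\<not> (y \<in> S \<and> z \<in> S)"
  proof
    assume yz: "y \<in> S \<and> z \<in> S"
    have xS: "x \<in> S" using S unfolding good_def by blast
    let ?J = "{j \<in> J. ends j \<subseteq> S}"
    let ?T = "{x, y, z}"
    \<comment> \<open>Counting incidences inside \<open>S\<close> gives 2|?J| <= 2(|S| - 3) + 3,
      against |S| - 1 <= |?J|.\<close>
    have "2 * card ?J = (\<Sum>j\<in>?J. card {v \<in> S. v \<in> ends j})"
    proof -
      have "card {v \<in> S. v \<in> ends j} = 2" if "j \<in> ?J" for j
      proof -
        have "{v \<in> S. v \<in> ends j} = ends j" using that by auto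
        then show ?thesis using two that by simp
      qed
      then show ?thesis by simp
    qed
    also have "\<dots> = (\<Sum>v\<in>S. card {j \<in> ?J. v \<in> ends j})"
      using fin finS by (intro sum_multicount_gen) auto
    also have "\<dots> \<le> (\<Sum>v\<in>S. card {j \<in> J. v \<in> ends j})"
      using fin by (intro sum_mono card_mono) auto
    also have "\<dots> = (\<Sum>v\<in>S - ?T. card {j \<in> J. v \<in> ends j}) + (\<Sum>v\<in>?T. card {j \<in> J. v \<in> ends j})"
      using finS xS yz by (intro sum.subset_diff) auto
    also have "\<dots> \<le> (\<Sum>v\<in>S - ?T. 2) + 3"
    proof (rule add_mono)
      show "(\<Sum>v\<in>S - ?T. card {j \<in> J. v \<in> ends j}) \<le> (\<Sum>v\<in>S - ?T. 2)"
        by (intro sum_mono deg)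
      show "(\<Sum>v\<in>?T. card {j \<in> J. v \<in> ends j}) \<le> 3"
        using low ne by simp
    qed
    finally have "2 * card ?J \<le> 2 * card (S - ?T) + 3" by simp
    moreover have "card (S - ?T) = card S - 3"
      using xS yz ne by (subst card_Diff_subset) auto
    moreover have "card ?T \<le> card S"
      using xS yz finS by (intro card_mono) auto
    then have "3 \<le> card S" using ne by simp
    ultimately show False
      using S unfolding good_def by linarith
  qed
  then show thesis
    using that[of S] S closed unfolding good_def by blast
qed

section \<open>Shannon's theorem\<close>

text \<open>Recoloring \<open>i\<close> with \<open>a\<close> frees its old color at
  \<open>x\<close>; that color is also missing at \<open>y\<close>, so \<open>e\<close> can take
  it.\<close>

lemma shift_coloring:
  assumes c: "edge_coloring ends I K c" and e: "e \<notin> I" "ends e = {x, y}"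
    and i: "i \<in> I" "ends i = {x, z}" "y \<notin> ends i"
    and a: "a \<in> missing ends I K c x" "a \<in> missing ends I K c z"
    and b: "c i \<in> missing ends I K c y"
  shows "\<exists>c. edge_coloring ends (insert e I) K c"
proof -
  define c1 where "c1 = c(i := a)"
  have "edge_coloring ends (insert i I) K c1"
    unfolding c1_def using a i by (intro edge_coloring_insert[OF c]) (auto simp: missing_def)
  then have c1: "edge_coloring ends I K c1"
    using i by (simp add: insert_absorb)
  have "c i < K" using b unfolding missing_def by simp
  moreover have "c1 j \<noteq> c i" if j: "j \<in> I" "x \<in> ends j \<or> y \<in> ends j" for j
  proof (cases "j = i")
    case True
    then show ?thesis
      using a i unfolding c1_def missing_def by auto
  next
    case False
    then have "c j \<noteq> c i"
      using j b i edge_coloringD[OF c j(1) i(1)] unfolding missing_def by blast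
    then show ?thesis using False unfolding c1_def by simp
  qed
  ultimately have "edge_coloring ends (insert e I) K (c1(e := c i))"
    using e by (intro edge_coloring_insert[OF c1]) (auto simp: missing_def)
  then show ?thesis by blast
qed

text \<open>If no color is missing at both ends of \<open>e\<close>, a third vertex \<open>z\<close>
  is reached from \<open>x\<close> by an edge whose color is missing at \<open>y\<close>. Counting
  forces two of the three missing sets to meet; a shift, preceded by a Kempe swap if necessary, then
  makes room for \<open>e\<close>.\<close>

lemma Shannon_step:
  fixes ends :: "'i \<Rightarrow> 'n set"
  assumes fin: "finite I" and e: "e \<notin> I"
    and two: "\<And>i. i \<in> insert e I \<Longrightarrow> card (ends i) = 2"
    and deg: "\<And>v. card {i \<in> insert e I. v \<in> ends i} \<le> D"
    and K: "3 * D \<le> 2 * K + 1"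
    and c: "edge_coloring ends I K c"
  shows "\<exists>c. edge_coloring ends (insert e I) K c"
proof -
  let ?M = "missing ends I K c"
  obtain x y where xy: "ends e = {x, y}" "x \<noteq> y"
    using two[of e] by (auto simp: card_2_iff)
  have degI: "card {i \<in> I. v \<in> ends i} \<le> D" for v
    using card_mono[of "{i \<in> insert e I. v \<in> ends i}" "{i \<in> I. v \<in> ends i}"] deg[of v] fin
    by fastforce
  have dege: "card {i \<in> I. v \<in> ends i} + 1 \<le> D" if "v \<in> ends e" for v
  proof -
    have "{i \<in> insert e I. v \<in> ends i} = insert e {i \<in> I. v \<in> ends i}"
      using that by auto
    then show ?thesis using deg[of v] fin e by simp
  qed
  \<comment> \<open>The uncolored edge \<open>e\<close> occupies one unit of degree at
    \<open>x\<close> and at \<open>y\<close>, which gives each an extra missing color.\<close>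
  have Mx: "K + 1 \<le> card (?M x) + D" and My: "K + 1 \<le> card (?M y) + D"
    using card_missing[OF fin, of K ends c x] card_missing[OF fin, of K ends c y] dege xy
    by fastforce+
  have Mv: "K \<le> card (?M v) + D" for v
    using card_missing[OF fin, of K ends c v] degI[of v] by linarith
  have "1 \<le> D" using dege[of x] xy by auto
  then have ne: "?M x \<noteq> {}" "?M y \<noteq> {}"
    using Mx My K by auto
  show ?thesis
  proof (cases "?M x \<inter> ?M y = {}")
    case False
    then obtain a where a: "a \<in> ?M x" "a \<in> ?M y" by blast
    have "edge_coloring ends (insert e I) K (c(e := a))"
      using a xy by (intro edge_coloring_insert[OF c]) (auto simp: missing_def)
    then show ?thesis by blast
  next
    case disj: True
    obtain b where b: "b \<in> ?M y" using ne by blast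
    then have "b \<notin> ?M x" "b < K"
      using disj by (auto simp: missing_def)
    then obtain i where i: "i \<in> I" "x \<in> ends i" "c i = b"
      unfolding missing_def by auto
    obtain z where z: "ends i = {x, z}" "x \<noteq> z"
      using two[of i] i by (auto simp: card_2_iff doubleton_eq_iff)
    have yi: "y \<notin> ends i"
      using b i unfolding missing_def by auto
    then have yz: "y \<noteq> z" using z by auto
    \<comment> \<open>Three disjoint sets would have at least 3K + 2 - 3D elements, which exceeds
      \<open>K\<close> exactly when 3D <= 2K + 1.\<close>
    have "\<not> (?M x \<inter> ?M z = {} \<and> ?M y \<inter> ?M z = {})"
    proof
      assume "?M x \<inter> ?M z = {} \<and> ?M y \<inter> ?M z = {}"
      then have "card (?M x \<union> ?M y \<union> ?M z) = card (?M x) + card (?M y) + card (?M z)"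
        using disj by (subst card_Un_disjoint; (subst card_Un_disjoint)?)
          (auto simp: finite_missing)
      moreover have "card (?M x \<union> ?M y \<union> ?M z) \<le> card {..<K}"
        by (intro card_mono) (auto simp: missing_def)
      ultimately show False
        using Mx My Mv[of z] K by simp
    qed
    then consider a where "a \<in> ?M x" "a \<in> ?M z" | g where "g \<in> ?M y" "g \<in> ?M z"
      by blast
    then show ?thesis
    proof cases
      case 1
      then show ?thesis
        using shift_coloring[OF c e xy(1) i(1) z(1) yi] b i by blast
    next
      case (2 g)
      obtain a where a: "a \<in> ?M x" using ne by blast
      have ag: "a < K" "g < K" "a \<noteq> g"
        using a 2 disj by (auto simp: missing_def)
      \<comment> \<open>The edge \<open>i\<close> meets both \<open>x\<close> and \<open>z\<close>,
        so its color \<open>b\<close> is missing at neither; the swap of \<open>a\<close> and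
        \<open>g\<close> will not touch \<open>b\<close>.\<close>
      have bag: "b \<noteq> a" "b \<noteq> g"
        using a 2 i z by (auto simp: missing_def)
      \<comment> \<open>In the subgraph colored \<open>a\<close> or \<open>g\<close> all degrees are
        at most 2, and each of \<open>x\<close>, \<open>y\<close>, \<open>z\<close> misses one of
        the two colors.\<close>
      define J where "J = {j \<in> I. c j = a \<or> c j = g}"
      define col where "col = (\<lambda>d v. {j \<in> I. c j = d \<and> v \<in> ends j})"
      have col1: "card (col d v) \<le> 1" for d v
      proof -
        have "j = j'" if "j \<in> col d v" "j' \<in> col d v" for j j'
          using that edge_coloringD[OF c, of j j' v] unfolding col_def by auto
        moreover have "finite (col d v)" using fin unfolding col_def by simp
        ultimately show ?thesis
          by (metis One_nat_def card_le_Suc0_iff_eq)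
      qed
      have Jsplit: "{j \<in> J. v \<in> ends j} = col a v \<union> col g v" for v
        unfolding J_def col_def by auto
      have deg2: "card {j \<in> J. v \<in> ends j} \<le> 2" for v
        unfolding Jsplit
        using card_Un_le[of "col a v" "col g v"] col1[of a v] col1[of g v] by linarith
      have low: "card {j \<in> J. v \<in> ends j} \<le> 1" if "a \<in> ?M v \<or> g \<in> ?M v" for v
      proof -
        have "col a v = {} \<or> col g v = {}"
          using that unfolding missing_def col_def by auto
        then show ?thesis
          unfolding Jsplit using col1[of a v] col1[of g v] by (elim disjE) simp_all
      qed
      have finJ: "finite J" and twoJ: "\<And>j. j \<in> J \<Longrightarrow> card (ends j) = 2"
        unfolding J_def using fin two by simp_all
      have lows: "card {j \<in> J. x \<in> ends j} \<le> 1" "card {j \<in> J. y \<in> ends j} \<le> 1"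
        "card {j \<in> J. z \<in> ends j} \<le> 1"
        using low a 2 by simp_all
      obtain C where C: "x \<in> C" "\<And>j. j \<in> J \<Longrightarrow> ends j \<subseteq> C \<or> ends j \<inter> C = {}"
        "\<not> (y \<in> C \<and> z \<in> C)"
        by (rule component_avoiding_low_degree[OF finJ twoJ deg2 lows xy(2) z(2) yz]) blast+
      have closed: "ends i \<subseteq> C \<or> ends i \<inter> C = {}" if "i \<in> I" "c i = a \<or> c i = g" for i
        using C(2) that unfolding J_def by simp
      obtain c' where c': "edge_coloring ends I K c'"
        and same: "\<And>i. i \<in> I \<Longrightarrow> c i \<noteq> a \<Longrightarrow> c i \<noteq> g \<Longrightarrow> c' i = c i"
        and out: "\<And>x. x \<notin> C \<Longrightarrow> missing ends I K c x \<subseteq> missing ends I K c' x"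
        and other: "\<And>x d. d \<in> missing ends I K c x \<Longrightarrow> d \<noteq> a \<Longrightarrow> d \<noteq> g \<Longrightarrow>
          d \<in> missing ends I K c' x"
        and sw: "\<And>x. x \<in> C \<Longrightarrow> a \<in> missing ends I K c x \<Longrightarrow> g \<in> missing ends I K c' x"
        by (rule Kempe_swap[OF c ag(1,2) closed]) blast+
      \<comment> \<open>Swapping on the part containing \<open>x\<close> makes \<open>g\<close>
        missing at \<open>x\<close>, while \<open>g\<close> stays missing at \<open>y\<close> or at
        \<open>z\<close>.\<close>
      have gx: "g \<in> missing ends I K c' x"
        using sw C a by blast
      show ?thesis
      proof (cases "y \<in> C")
        case False
        then have "g \<in> missing ends I K c' y" using out 2 by blast
        then have "edge_coloring ends (insert e I) K (c'(e := g))"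
          using gx xy by (intro edge_coloring_insert[OF c']) (auto simp: missing_def)
        then show ?thesis by blast
      next
        case True
        then have "g \<in> missing ends I K c' z" using out 2 C by blast
        moreover have "c' i = b" using same i bag by simp
        moreover have "b \<in> missing ends I K c' y" using other b bag by blast
        ultimately show ?thesis
          using shift_coloring[OF c' e xy(1) i(1) z(1) yi gx] by blast
      qed
    qed
  qed
qed

text \<open>Edges are inserted one at a time. The condition on \<open>K\<close> says that
  \<open>K\<close> is at least the floor of 3D/2, Shannon's bound.\<close>

theorem Shannon:
  fixes ends :: "'i \<Rightarrow> 'n set"
  assumes "finite I" and "\<And>i. i \<in> I \<Longrightarrow> card (ends i) = 2"
    and "\<And>v. card {i \<in> I. v \<in> ends i} \<le> D"
    and "3 * D \<le> 2 * K + 1"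
  shows "\<exists>c. edge_coloring ends I K c"
  using assms(1-3)
proof (induction I rule: finite_induct)
  case empty
  then show ?case by (simp add: edge_coloring_def)
next
  case (insert e I)
  have "card {i \<in> I. v \<in> ends i} \<le> D" for v
    using card_mono[of "{i \<in> insert e I. v \<in> ends i}" "{i \<in> I. v \<in> ends i}"]
      insert.prems(2)[of v] insert.hyps by fastforce
  then obtain c where "edge_coloring ends I K c"
    using insert.IH insert.prems(1) by blast
  then show ?case
    using Shannon_step[OF insert.hyps insert.prems assms(4)] by blast
qed

section \<open>Paths in trees\<close>

lemma walk_edges_append:
  "walk_edges (xs @ t # ys) = walk_edges (xs @ [t]) \<union> walk_edges (t # ys)"
proof (induction xs)
  case (Cons x xs)
  then show ?case by (cases xs) auto
qed simp

lemma walk_edges_rev: "walk_edges (rev p) = walk_edges p"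
proof (induction p rule: walk_edges.induct)
  case (1 x y zs)
  then show ?case
    using walk_edges_append[of "rev zs" y "[x]"] by (simp add: insert_commute[of y x])
qed auto

lemma walk_edges_subset: "e \<in> walk_edges p \<Longrightarrow> e \<subseteq> set p"
  by (induction p rule: walk_edges.induct) auto

lemma walk_edges_at_hd:
  assumes "distinct (x # p)" "e \<in> walk_edges (x # p)" "x \<in> e"
  shows "p \<noteq> [] \<and> e = {x, hd p}"
  using assms walk_edges_subset[of e p] by (cases p) auto

lemma card_walk_edges_at:
  assumes "distinct p"
  shows "card {e \<in> walk_edges p. v \<in> e} \<le> 2"
  using assms
proof (induction p rule: walk_edges.induct)
  case (1 x y zs)
  show ?case
  proof (cases "v = x \<or> v = y")
    case True
    \<comment> \<open>If \<open>zs\<close> is empty, \<open>hd zs\<close> is unspecified; this is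
      harmless, since only an upper bound is required.\<close>
    have "{e \<in> walk_edges (x # y # zs). v \<in> e} \<subseteq> {{x, y}, {y, hd zs}}"
    proof
      fix e assume e: "e \<in> {e \<in> walk_edges (x # y # zs). v \<in> e}"
      show "e \<in> {{x, y}, {y, hd zs}}"
      proof (cases "e = {x, y}")
        case False
        then have "e \<in> walk_edges (y # zs)" using e by auto
        moreover from this have "v = y"
          using walk_edges_subset True e 1(2) by fastforce
        ultimately show ?thesis
          using walk_edges_at_hd[of y zs e] e 1(2) by auto
      qed simp
    qed
    then have "card {e \<in> walk_edges (x # y # zs). v \<in> e} \<le> card {{x, y}, {y, hd zs}}"
      by (intro card_mono) auto
    also have "\<dots> \<le> 2" by (simp add: card_insert_if)
    finally show ?thesis .
  next
    case False
    then have "{e \<in> walk_edges (x # y # zs). v \<in> e} = {e \<in> walk_edges (y # zs). v \<in> e}"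
      by auto
    then show ?thesis using 1 by auto
  qed
qed auto

section \<open>Paths entering a connected set\<close>

text \<open>Otherwise the path from \<open>u\<close> to its first vertex \<open>t\<close> in
  \<open>S\<close>, a path from \<open>t\<close> to \<open>s\<close> inside \<open>S\<close> and the
  edge between \<open>s\<close> and \<open>u\<close> would form a cycle.\<close>

lemma first_edge_into_connected:
  assumes acyc: "\<nexists>p. graph_cycle V E p" and S: "S \<subseteq> V" "connected_graph S E"
    and u: "u \<in> V - S" "s \<in> S" "{u, s} \<in> E"
    and p: "distinct (u # r)" "set r \<subseteq> V" "walk_edges (u # r) \<subseteq> E" "set r \<inter> S \<noteq> {}"
  shows "r \<noteq> [] \<and> hd r = s"
proof (rule ccontr)
  assume contra: "\<not> ?thesis"
  obtain b t d where r: "r = b @ t # d" "t \<in> S" "\<forall>z\<in>set b. z \<notin> S"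
    using split_list_first_prop[of r "\<lambda>z. z \<in> S"] p(4) by auto
  obtain w where w: "path_between S E t w s"
    using S(2) r u unfolding connected_graph_def by blast
  then obtain w' where w': "w = t # w'"
    unfolding path_between_def by (cases w) auto
  have "walk_edges ((u # b) @ [t]) \<subseteq> E"
    using p(3) r walk_edges_append[of "u # b" t d] by auto
  moreover have "walk_edges (t # w') \<subseteq> E"
    using w w' unfolding path_between_def by auto
  ultimately have "walk_edges (u # b @ w) \<subseteq> E"
    using walk_edges_append[of "u # b" t w'] w' by auto
  moreover have "distinct (u # b @ w)"
    using p(1) r w u unfolding path_between_def by auto
  moreover have "set (u # b @ w) \<subseteq> V"
    using p(2) r w u S unfolding path_between_def by auto
  \<comment> \<open>If \<open>u\<close> is adjacent to \<open>t\<close> on the path, then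
    \<open>t\<close> differs from \<open>s\<close>, so \<open>w\<close> has a second vertex.\<close>
  moreover have "length (u # b @ w) \<ge> 3"
  proof (cases b)
    case Nil
    then have "t \<noteq> s" using contra r by auto
    then have "w' \<noteq> []" using w w' unfolding path_between_def by auto
    then show ?thesis using w' by (cases w') auto
  next
    case Cons
    then show ?thesis using w' by simp
  qed
  moreover have "{last (u # b @ w), hd (u # b @ w)} \<in> E"
    using w u unfolding path_between_def by (auto simp: insert_commute)
  ultimately show False
    using acyc unfolding graph_cycle_def by blast
qed

text \<open>The path visits \<open>S\<close> after \<open>u\<close> or before \<open>u\<close>;
  reversal reduces the second case to the first, where the next vertex after \<open>u\<close> must
  be \<open>s\<close>.\<close>

lemma path_uses_bridge:
  assumes acyc: "\<nexists>p. graph_cycle V E p" and S: "S \<subseteq> V" "connected_graph S E"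
    and u: "u \<in> V - S" "s \<in> S" "{u, s} \<in> E"
    and p: "distinct p" "set p \<subseteq> V" "walk_edges p \<subseteq> E" "set p \<inter> S \<noteq> {}" "u \<in> set p"
  shows "{u, s} \<in> walk_edges p"
proof -
  have suffix: "{u, s} \<in> walk_edges q"
    if q: "distinct q" "set q \<subseteq> V" "walk_edges q \<subseteq> E" and split: "q = a @ u # r"
      and ne: "set r \<inter> S \<noteq> {}" for q a r
  proof -
    have "r \<noteq> [] \<and> hd r = s"
      using q split ne walk_edges_append[of a u r]
      by (intro first_edge_into_connected[OF acyc S u]) auto
    then show ?thesis
      using split walk_edges_append[of a u r] by (cases r) auto
  qed
  obtain a r where ar: "p = a @ u # r"
    using p(5) split_list by metis
  then consider "set r \<inter> S \<noteq> {}" | "set (rev a) \<inter> S \<noteq> {}"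
    using p(4) u(1) by auto
  then show ?thesis
  proof cases
    case 1
    then show ?thesis using suffix p ar by blast
  next
    case 2
    moreover have "walk_edges (rev p) \<subseteq> E" "rev p = rev r @ u # rev a"
      using p(3) ar by (simp_all only: walk_edges_rev) simp
    ultimately have "{u, s} \<in> walk_edges (rev p)"
      using p(1,2) suffix by (metis distinct_rev set_rev)
    then show ?thesis by (simp add: walk_edges_rev)
  qed
qed

lemma path_between_sub:
  assumes "distinct p" "walk_edges p \<subseteq> E" "x \<in> set p" "y \<in> set p"
  shows "\<exists>q. path_between (set p) E x q y"
proof -
  have aux: "\<exists>q. path_between (set p) E x q y"
    if p: "distinct p" "walk_edges p \<subseteq> E" "p = a @ x # r" "y \<in> set (x # r)" for p a r x y
  proof -
    obtain b d where bd: "x # r = b @ y # d"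
      using p(4) split_list by metis
    have "path_between (set p) E x (b @ [y]) y"
      unfolding path_between_def
    proof (intro conjI)
      show "hd (b @ [y]) = x" using bd by (cases b) auto
      show "walk_edges (b @ [y]) \<subseteq> E"
        using p bd walk_edges_append[of a x r] walk_edges_append[of b y d] by auto
      show "distinct (b @ [y])" "set (b @ [y]) \<subseteq> set p"
        using p bd by auto
    qed auto
    then show ?thesis by blast
  qed
  obtain a r where ar: "p = a @ x # r"
    using assms(3) split_list by metis
  show ?thesis
  proof (cases "y \<in> set (x # r)")
    case True
    then show ?thesis using aux assms ar by blast
  next
    case False
    then have "y \<in> set (x # rev a)" using assms(4) ar by auto
    moreover have "walk_edges (rev p) \<subseteq> E" "rev p = rev r @ x # rev a"
      using assms(2) ar by (simp_all only: walk_edges_rev) simp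
    ultimately have "\<exists>q. path_between (set (rev p)) E x q y"
      using assms(1) aux by (metis distinct_rev set_simps(2) set_rev)
    then show ?thesis by simp
  qed
qed

lemma connected_graph_path:
  assumes "distinct p" "walk_edges p \<subseteq> E" "p \<noteq> []"
  shows "connected_graph (set p) E"
  using path_between_sub[OF assms(1,2)] assms(3) unfolding connected_graph_def by auto

section \<open>Uniqueness of paths and the routing\<close>

text \<open>The tail of the first path is a connected set avoiding \<open>x\<close>, and the second
  path reaches it at \<open>y\<close>. Hence both begin with the same edge, and induction applies to
  the tails.\<close>

lemma tree_path_unique:
  assumes acyc: "\<nexists>p. graph_cycle V E p"
    and "path_between V E x p y" "path_between V E x q y"
  shows "p = q"
  using assms(2,3)
proof (induction p arbitrary: x q)
  case Nil
  then show ?case by (simp add: path_between_def)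
next
  case (Cons x' p)
  then have x': "x' = x" by (simp add: path_between_def)
  obtain q' where q: "q = x # q'"
    using Cons.prems(2) unfolding path_between_def by (cases q) auto
  show ?case
  proof (cases "p = []")
    case True
    then have "y = x" using Cons.prems(1) x' by (simp add: path_between_def)
    then have "q' = []"
      using Cons.prems(2) q last_in_set[of q'] unfolding path_between_def by (auto split: if_splits)
    then show ?thesis using True q x' by simp
  next
    case False
    then obtain s p' where p: "p = s # p'" by (cases p) auto
    have y: "y \<in> set p" "y \<noteq> x"
      using Cons.prems(1) False x' unfolding path_between_def by auto
    have conn: "connected_graph (set p) E"
      using Cons.prems(1) p unfolding path_between_def by (intro connected_graph_path) auto
    have "y \<in> set q'"
      using Cons.prems(2) q y last_in_set[of q] unfolding path_between_def by auto
    have hd: "q' \<noteq> [] \<and> hd q' = s"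
    proof (rule first_edge_into_connected[OF acyc _ conn, of x])
      show "set q' \<inter> set p \<noteq> {}" using \<open>y \<in> set q'\<close> y by blast
    qed (use Cons.prems x' p q in \<open>auto simp: path_between_def\<close>)
    have "path_between V E s p y"
      using Cons.prems(1) p unfolding path_between_def by auto
    moreover have "path_between V E s q' y"
      using Cons.prems(2) q hd unfolding path_between_def by (cases q') auto
    ultimately show ?thesis
      using Cons.IH q x' by blast
  qed
qed

lemma tree_path_eq:
  assumes "\<nexists>p. graph_cycle V E p" "path_between V E x p y"
  shows "tree_path V E x y = walk_edges p"
  unfolding tree_path_def using assms tree_path_unique[OF assms(1)] by (intro the_equality) blast+

lemma routing_path:
  assumes "is_tree V E" "P \<in> all_to_all_routing V E"
  obtains p where "distinct p" "set p \<subseteq> V" "walk_edges p \<subseteq> E" "P = walk_edges p"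
proof -
  obtain x y where xy: "P = tree_path V E x y" "x \<in> V" "y \<in> V"
    using assms(2) unfolding all_to_all_routing_def by auto
  then obtain p where "path_between V E x p y"
    using assms(1) unfolding is_tree_def connected_graph_def by blast
  then show thesis
    using that[of p] tree_path_eq[of V E x p y] assms(1) xy
    unfolding is_tree_def path_between_def by blast
qed

text \<open>These one-edge paths give the gain of 1 in the local degree bound and make the
  forwarding index positive.\<close>

lemma edge_in_routing:
  assumes "is_tree V E" "e \<in> E"
  shows "{e} \<in> all_to_all_routing V E"
proof -
  obtain x y where xy: "x \<in> V" "y \<in> V" "x \<noteq> y" "e = {x, y}"
    using assms unfolding is_tree_def simple_graph_def by blast
  then have "tree_path V E x y = {e}"
    using assms tree_path_eq[of V E x "[x, y]" y] unfolding is_tree_def path_between_def by simp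
  then show ?thesis
    using xy unfolding all_to_all_routing_def by blast
qed

lemma finite_tree_edges:
  assumes "is_tree V E"
  shows "finite E"
proof (rule finite_subset)
  show "E \<subseteq> Pow V" "finite (Pow V)"
    using assms unfolding is_tree_def simple_graph_def by auto
qed

lemma finite_routing:
  assumes "is_tree V E"
  shows "finite (all_to_all_routing V E)"
proof (rule finite_subset)
  show "all_to_all_routing V E \<subseteq> Pow E"
    using routing_path[OF assms] by blast
  show "finite (Pow E)"
    using finite_tree_edges[OF assms] by simp
qed

section \<open>Growing connected sets\<close>

lemma connected_graph_insert:
  assumes "connected_graph S E" "s \<in> S" "{u, s} \<in> E"
  shows "connected_graph (insert u S) E"
proof (cases "u \<in> S")
  case True
  then show ?thesis using assms by (simp add: insert_absorb)
next
  case u: False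
  have from_u: "\<exists>p. path_between (insert u S) E u p y" if y: "y \<in> S" for y
  proof -
    obtain p where "path_between S E s p y"
      using assms(1,2) y unfolding connected_graph_def by blast
    then have "path_between (insert u S) E u (u # p) y"
      using u assms(3) unfolding path_between_def by (cases p) auto
    then show ?thesis by blast
  qed
  have rev: "path_between W E y (rev p) x" if "path_between W E x p y" for W x y p
    using that unfolding path_between_def by (auto simp: walk_edges_rev hd_rev last_rev)
  have mono: "path_between (insert u S) E x p y" if "path_between S E x p y" for x p y
    using that unfolding path_between_def by auto
  have "\<exists>p. path_between (insert u S) E x p y" if xy: "x \<in> insert u S" "y \<in> insert u S" for x y
  proof -
    have "path_between (insert u S) E u [u] u"
      by (simp add: path_between_def)
    moreover have "\<exists>p. path_between S E x p y" if "x \<in> S" "y \<in> S"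
      using assms(1) that unfolding connected_graph_def by blast
    ultimately show ?thesis
      using xy from_u[of y] from_u[of x] rev mono by (elim insertE) blast+
  qed
  then show ?thesis
    unfolding connected_graph_def by blast
qed

lemma exists_boundary_edge:
  assumes "connected_graph V E" "S \<subseteq> V" "S \<noteq> {}" "S \<noteq> V"
  obtains u s where "u \<in> V - S" "s \<in> S" "{u, s} \<in> E"
proof -
  obtain x y where xy: "x \<in> S" "y \<in> V - S" using assms by blast
  then obtain p where p: "path_between V E x p y"
    using assms unfolding connected_graph_def by blast
  then have "\<exists>z\<in>set p. z \<notin> S"
    using xy last_in_set[of p] unfolding path_between_def by blast
  \<comment> \<open>\<open>u\<close> is the first vertex outside \<open>S\<close> on a path that
    starts in \<open>S\<close>; its predecessor is \<open>s\<close>.\<close>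
  then obtain a u r where r: "p = a @ u # r" "u \<notin> S" "\<forall>z\<in>set a. z \<in> S"
    using split_list_first_prop[of p "\<lambda>z. z \<notin> S"] by auto
  have "a \<noteq> []"
    using p r xy unfolding path_between_def by auto
  then obtain a' s where a: "a = a' @ [s]"
    by (metis append_butlast_last_id)
  have "{s, u} \<in> E"
    using p r a walk_edges_append[of a' s "u # r"] unfolding path_between_def by auto
  then show thesis
    using that[of u s] p r a unfolding path_between_def by (auto simp: insert_commute)
qed

section \<open>Gluing local colorings\<close>

text \<open>Sending \<open>g a\<close> to \<open>f a\<close> is a bijection between the two images;
  their complements among the \<open>K\<close> colors have equal size, so it extends to a
  permutation.\<close>

lemma exists_recoloring:
  fixes f g :: "'i \<Rightarrow> nat"
  assumes A: "finite A" and inj: "inj_on f A" "inj_on g A"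
    and ran: "f ` A \<subseteq> {..<K}" "g ` A \<subseteq> {..<K}"
  obtains h where "bij_betw h {..<K} {..<K}" "\<And>a. a \<in> A \<Longrightarrow> h (g a) = f a"
proof -
  have "card ({..<K} - g ` A) = card ({..<K} - f ` A)"
    using A inj ran by (simp add: card_Diff_subset card_image)
  then obtain k where k: "bij_betw k ({..<K} - g ` A) ({..<K} - f ` A)"
    using finite_same_card_bij[of "{..<K} - g ` A" "{..<K} - f ` A"] by auto
  define h where "h = (\<lambda>x. if x \<in> g ` A then f (inv_into A g x) else k x)"
  have "bij_betw (\<lambda>x. f (inv_into A g x)) (g ` A) (f ` A)"
    using bij_betw_trans[OF bij_betw_inv_into[of g A "g ` A"], of f "f ` A"] inj
    by (simp add: bij_betw_def o_def)
  then have "bij_betw h (g ` A) (f ` A)"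
    by (rule iffD1[OF bij_betw_cong, rotated]) (simp add: h_def)
  moreover have "bij_betw h ({..<K} - g ` A) ({..<K} - f ` A)"
    using k by (rule iffD1[OF bij_betw_cong, rotated]) (simp add: h_def)
  ultimately have "bij_betw h (g ` A \<union> ({..<K} - g ` A)) (f ` A \<union> ({..<K} - f ` A))"
    by (intro bij_betw_combine) auto
  moreover have "g ` A \<union> ({..<K} - g ` A) = {..<K}" "f ` A \<union> ({..<K} - f ` A) = {..<K}"
    using ran by auto
  ultimately have "bij_betw h {..<K} {..<K}" by simp
  moreover have "h (g a) = f a" if "a \<in> A" for a
    using that inj unfolding h_def by simp
  ultimately show thesis using that by blast
qed

abbreviation edges_at :: "'a set set \<Rightarrow> 'a set \<Rightarrow> 'a set set" where
  "edges_at E S \<equiv> {e \<in> E. e \<inter> S \<noteq> {}}"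

lemma glue_colorings:
  assumes fin: "finite R" and e: "e \<in> A" "e \<in> B"
    and bridge: "\<And>P. P \<in> R \<Longrightarrow> P \<inter> A \<noteq> {} \<Longrightarrow> P \<inter> B \<noteq> {} \<Longrightarrow> e \<in> P"
    and f: "edge_coloring (\<lambda>P. P \<inter> A) R K f"
    and g: "edge_coloring (\<lambda>P. P \<inter> B) R K g"
  shows "\<exists>h. edge_coloring (\<lambda>P. P \<inter> (A \<union> B)) R K h"
proof -
  \<comment> \<open>Paths through \<open>e\<close> pairwise conflict in both colorings, so
    \<open>f\<close> and \<open>g\<close> are injective on this set.\<close>
  let ?R = "{P \<in> R. e \<in> P}"
  obtain h where h: "bij_betw h {..<K} {..<K}" "\<And>P. P \<in> ?R \<Longrightarrow> h (g P) = f P"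
  proof (rule exists_recoloring[of ?R f g K])
    show "inj_on f ?R" "inj_on g ?R"
      using edge_coloringD[OF f, of _ _ e] edge_coloringD[OF g, of _ _ e] e
      by (auto intro!: inj_onI)
  qed (use fin f g in \<open>auto simp: edge_coloring_def\<close>)
  \<comment> \<open>Paths that meet neither \<open>A\<close> nor \<open>B\<close> also fall under
    the second branch; for them only the range matters.\<close>
  define k where "k = (\<lambda>P. if P \<inter> A \<noteq> {} then f P else h (g P))"
  have kB: "k P = h (g P)" if "P \<in> R" "P \<inter> B \<noteq> {}" for P
    using that bridge h(2) unfolding k_def by auto
  have hlt: "h d < K" if "d < K" for d
    using that bij_betwE[OF h(1)] by auto
  have "edge_coloring (\<lambda>P. P \<inter> (A \<union> B)) R K k"
    unfolding edge_coloring_def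
  proof (intro conjI ballI impI)
    fix P assume "P \<in> R"
    then show "k P < K"
      using f g hlt unfolding edge_coloring_def k_def by auto
  next
    fix P Q assume P: "P \<in> R" and Q: "Q \<in> R" and ne: "P \<noteq> Q \<and> P \<inter> (A \<union> B) \<inter> (Q \<inter> (A \<union> B)) \<noteq> {}"
    then obtain x where x: "x \<in> P" "x \<in> Q" "x \<in> A \<or> x \<in> B" by blast
    then show "k P \<noteq> k Q"
    proof (cases "x \<in> A")
      case True
      then have "k P = f P" "k Q = f Q" using x unfolding k_def by auto
      then show ?thesis
        using edge_coloringD[OF f P Q, of x] True x ne by auto
    next
      case False
      then have B: "x \<in> B" using x by blast
      then have "k P = h (g P)" "k Q = h (g Q)" using kB P Q x by blast+
      moreover have "g P \<noteq> g Q"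
        using edge_coloringD[OF g P Q, of x] B x ne by auto
      moreover have "g P < K" "g Q < K"
        using g P Q unfolding edge_coloring_def by auto
      ultimately show ?thesis
        using h(1) unfolding bij_betw_def inj_on_def by auto
    qed
  qed
  then show ?thesis by blast
qed

text \<open>A connected set of maximal size whose incident edges admit a coloring must be all of
  \<open>V\<close>: otherwise a boundary edge would allow one more local coloring to be glued
  on.\<close>

lemma global_coloring:
  assumes T: "is_tree V E"
    and loc: "\<And>v. v \<in> V \<Longrightarrow>
      \<exists>c. edge_coloring (\<lambda>P. P \<inter> edges_at E {v}) (all_to_all_routing V E) K c"
  shows "\<exists>c. edge_coloring (\<lambda>P. P \<inter> E) (all_to_all_routing V E) K c"
proof -
  let ?R = "all_to_all_routing V E"
  have finV: "finite V" and conn: "connected_graph V E" and acyc: "\<nexists>p. graph_cycle V E p"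
    using T unfolding is_tree_def simple_graph_def by auto
  define good where "good = (\<lambda>S. S \<subseteq> V \<and> connected_graph S E \<and>
    (\<exists>c. edge_coloring (\<lambda>P. P \<inter> edges_at E S) ?R K c))"
  obtain v where v: "v \<in> V" using conn unfolding connected_graph_def by blast
  have "connected_graph {v} E"
    using connected_graph_path[of "[v]" E] by simp
  then have "good {v}" using v loc unfolding good_def by blast
  moreover have "\<forall>S. good S \<longrightarrow> card S < Suc (card V)"
    using card_mono[OF finV] unfolding good_def by (auto simp: less_Suc_eq_le)
  ultimately obtain S where S: "good S" and max: "\<And>S'. good S' \<Longrightarrow> card S' \<le> card S"
    using ex_has_greatest_nat[of good "{v}" card "Suc (card V)"] by blast
  then have SV: "S \<subseteq> V" and connS: "connected_graph S E"
    unfolding good_def by auto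
  obtain f where f: "edge_coloring (\<lambda>P. P \<inter> edges_at E S) ?R K f"
    using S unfolding good_def by blast
  have "S = V"
  proof (rule ccontr)
    assume "S \<noteq> V"
    moreover have "S \<noteq> {}" using connS unfolding connected_graph_def by blast
    ultimately obtain u s where us: "u \<in> V - S" "s \<in> S" "{u, s} \<in> E"
      using exists_boundary_edge[OF conn SV] by blast
    obtain g where g: "edge_coloring (\<lambda>P. P \<inter> edges_at E {u}) ?R K g"
      using loc us by blast
    have bridge: "{u, s} \<in> P"
      if P: "P \<in> ?R" "P \<inter> edges_at E S \<noteq> {}" "P \<inter> edges_at E {u} \<noteq> {}" for P
    proof -
      obtain p where p: "distinct p" "set p \<subseteq> V" "walk_edges p \<subseteq> E" "P = walk_edges p"
        using routing_path[OF T P(1)] by blast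
      have "set p \<inter> S \<noteq> {}" "u \<in> set p"
        using P p(4) walk_edges_subset[of _ p] by blast+
      then show ?thesis
        using path_uses_bridge[OF acyc SV connS us p(1-3)] p(4) by blast
    qed
    have "\<exists>h. edge_coloring (\<lambda>P. P \<inter> (edges_at E S \<union> edges_at E {u})) ?R K h"
      using us bridge by (intro glue_colorings[OF finite_routing[OF T] _ _ _ f g, of "{u, s}"]) auto
    moreover have "edges_at E S \<union> edges_at E {u} = edges_at E (insert u S)" by auto
    ultimately have "good (insert u S)"
      using us SV connected_graph_insert[OF connS us(2,3)] unfolding good_def by auto
    then show False
      using max[of "insert u S"] us finite_subset[OF SV finV] by simp
  qed
  moreover have "edges_at E V = E"
    using T unfolding is_tree_def simple_graph_def by auto
  ultimately show ?thesis using f by auto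
qed

section \<open>Coloring at one vertex\<close>

text \<open>The routing path consisting of the single edge \<open>e\<close> ends at \<open>v\<close>; hence the paths passing
  through \<open>v\<close> form a multigraph of maximum degree at most \<open>\<pi> - 1\<close>, which gives strictness.\<close>

lemma local_coloring:
  fixes V :: "'a set" and E :: "'a set set"
  assumes T: "is_tree V E"
    and load: "\<And>e. e \<in> E \<Longrightarrow> edge_load V E e \<le> L"
    and K: "L \<le> K" "3 * (L - 1) \<le> 2 * K + 1" "0 < K"
  shows "\<exists>c. edge_coloring (\<lambda>P. P \<inter> edges_at E {v}) (all_to_all_routing V E) K c"
proof -
  let ?R = "all_to_all_routing V E"
  let ?ends = "\<lambda>P. P \<inter> edges_at E {v}"
  \<comment> \<open>\<open>I\<close> consists of the paths passing through \<open>v\<close>,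
    \<open>J\<close> of those ending at \<open>v\<close>.\<close>
  define I where "I = {P \<in> ?R. card (?ends P) = 2}"
  define J where "J = {P \<in> ?R. card (?ends P) = 1}"
  have finR: "finite ?R" using finite_routing[OF T] .
  have finE: "finite E" using finite_tree_edges[OF T] .
  have degI: "card {P \<in> I. e \<in> ?ends P} \<le> L - 1" for e
  proof (cases "e \<in> edges_at E {v}")
    case True
    \<comment> \<open>The path \<open>{e}\<close> loads \<open>e\<close> but has only one edge at
      \<open>v\<close>, so it is not in \<open>I\<close>.\<close>
    have "{P \<in> I. e \<in> ?ends P} \<subseteq> {P \<in> ?R. e \<in> P} - {{e}}"
      using True by (auto simp: I_def)
    then have "card {P \<in> I. e \<in> ?ends P} \<le> card ({P \<in> ?R. e \<in> P} - {{e}})"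
      using finR by (intro card_mono) auto
    also have "\<dots> = edge_load V E e - 1"
      using edge_in_routing[OF T, of e] True unfolding edge_load_def by simp
    also have "\<dots> \<le> L - 1" using load[of e] True by auto
    finally show ?thesis .
  next
    case False
    then have "{P \<in> I. e \<in> ?ends P} = {}" by blast
    then show ?thesis by (metis card.empty le0)
  qed
  have "finite I" "finite J" using finR by (auto simp: I_def J_def)
  obtain c where c: "edge_coloring ?ends I K c"
    using Shannon[OF \<open>finite I\<close> _ degI K(2)] unfolding I_def by blast
  have degIJ: "card {P \<in> I \<union> J. e \<in> ?ends P} \<le> K" for e
  proof (cases "e \<in> E")
    case True
    have "card {P \<in> I \<union> J. e \<in> ?ends P} \<le> edge_load V E e"
      unfolding edge_load_def using finR by (intro card_mono) (auto simp: I_def J_def)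
    then show ?thesis using load[OF True] K by simp
  next
    case False
    then have "{P \<in> I \<union> J. e \<in> ?ends P} = {}" by blast
    then show ?thesis by (metis card.empty le0)
  qed
  obtain d where d: "edge_coloring ?ends (I \<union> J) K d"
    using edge_coloring_greedy[OF \<open>finite J\<close> c \<open>finite I\<close> _ degIJ] unfolding J_def by blast
  \<comment> \<open>Paths avoiding \<open>v\<close> conflict with nothing here; the default color 0
    is legal because \<open>K\<close> is positive.\<close>
  define d' where "d' = (\<lambda>P. if P \<in> I \<union> J then d P else 0)"
  have in_IJ: "P \<in> I \<union> J" if P: "P \<in> ?R" "?ends P \<noteq> {}" for P
  proof -
    obtain p where p: "distinct p" "walk_edges p \<subseteq> E" "P = walk_edges p"
      using routing_path[OF T P(1)] by blast
    have "?ends P = {e \<in> walk_edges p. v \<in> e}" using p by auto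
    then have "card (?ends P) \<le> 2" using card_walk_edges_at[OF p(1)] by simp
    moreover have "card (?ends P) \<noteq> 0" using P(2) finE by simp
    ultimately show ?thesis using P(1) unfolding I_def J_def by auto
  qed
  have "edge_coloring ?ends ?R K d'"
    unfolding edge_coloring_def
  proof (intro conjI ballI impI)
    fix P assume "P \<in> ?R"
    then show "d' P < K" using d K(3) unfolding d'_def edge_coloring_def by auto
  next
    fix P Q assume P: "P \<in> ?R" "Q \<in> ?R" "P \<noteq> Q \<and> ?ends P \<inter> ?ends Q \<noteq> {}"
    then have "P \<in> I \<union> J" "Q \<in> I \<union> J" using in_IJ[of P] in_IJ[of Q] by blast+
    then show "d' P \<noteq> d' Q"
      using d P(3) unfolding d'_def edge_coloring_def by simp
  qed
  then show ?thesis by blast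
qed

section \<open>The bound on the optical index\<close>

theorem theorem2p2:
  fixes V :: "'a set" and E :: "'a set set" and n :: nat
  assumes "is_tree V E" and "card V = n" and "n \<ge> 2"
  shows "real (optical_index V E) < 3 / 2 * real (edge_forwarding_index V E)"
proof -
  let ?R = "all_to_all_routing V E"
  define L where "L = edge_forwarding_index V E"
  \<comment> \<open>The first entry is what the greedy step requires, the second is what Shannon's
    theorem requires for maximum degree \<open>L - 1\<close>; both are below 3L/2 once
    \<open>L\<close> is positive.\<close>
  define K where "K = max L (3 * (L - 1) div 2)"
  have finE: "finite E" using finite_tree_edges[OF assms(1)] .
  have load: "edge_load V E e \<le> L" if "e \<in> E" for e
    unfolding L_def edge_forwarding_index_def using that finE by simp
  have conn: "connected_graph V E" using assms(1) unfolding is_tree_def by blast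
  then obtain v where v: "v \<in> V" unfolding connected_graph_def by blast
  \<comment> \<open>Two vertices guarantee an edge, hence a positive \<open>L\<close>.\<close>
  have "V \<noteq> {v}" using assms(2,3) by auto
  then obtain e where e: "e \<in> E"
    using exists_boundary_edge[OF conn, of "{v}"] v by blast
  have "{e} \<in> {P \<in> ?R. e \<in> P}" using edge_in_routing[OF assms(1) e] by simp
  then have "edge_load V E e \<noteq> 0"
    using finite_routing[OF assms(1)] unfolding edge_load_def by auto
  then have L: "0 < L" using load[OF e] by simp
  have "\<exists>c. edge_coloring (\<lambda>P. P \<inter> E) ?R K c"
    using L by (intro global_coloring[OF assms(1)] local_coloring[OF assms(1) load])
      (auto simp: K_def)
  then obtain c where c: "edge_coloring (\<lambda>P. P \<inter> E) ?R K c" by blast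
  have sub: "P \<subseteq> E" if "P \<in> ?R" for P
    using routing_path[OF assms(1) that] by metis
  \<comment> \<open>\<open>Suc\<close> shifts the colors from 0, ..., K - 1 to 1, ..., K.\<close>
  have "proper_path_coloring V E K (\<lambda>P. Suc (c P))"
    unfolding proper_path_coloring_def
  proof (intro conjI ballI impI)
    show "(\<lambda>P. Suc (c P)) ` ?R \<subseteq> {1..K}"
      using c unfolding edge_coloring_def by (auto simp: Suc_le_eq)
  next
    fix P Q assume "P \<in> ?R" "Q \<in> ?R" "P \<noteq> Q \<and> P \<inter> Q \<noteq> {}"
    then show "Suc (c P) \<noteq> Suc (c Q)"
      using edge_coloringD[OF c, of P Q] sub by blast
  qed
  then have "optical_index V E \<le> K"
    unfolding optical_index_def by (intro Least_le) blast
  moreover have "2 * K < 3 * L"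
    using L unfolding K_def by (auto simp: max_def)
  ultimately show ?thesis
    unfolding L_def[symmetric] by linarith
qed

end
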